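(* There exists a bijective Costas cloud on $\mathbb{R}\times(0,1)$, i.e. a bijection $h:\mathbb{R}\to(0,1)$ that is discontinuous at every point of $\mathbb{R}$, whose graph is dense in $\mathbb{R}\times(0,1)$, and such that for all $x,y\in\mathbb{R}$ and all $t\in\mathbb{R}\setminus\{0\}$, $h(x+t)-h(x)=h(y+t)-h(y)$ implies $x=y$.
   Context: For intervals $A,B\subseteq\mathbb{R}$, a Costas cloud on $A\times B$ is an injection $f:A\to B$ which is discontinuous at every point of $A$, whose graph $\{(x,f(x)):x\in A\}$ is dense in $A\times B$, and which has the Costas property with respect to $T=\{t\in\mathbb{R}\setminus\{0\}:(t+A)\cap A\neq\emptyset\}$: for all $a_1,a_2\in A$ and $t\in T$ with $t+a_1,t+a_2\in A$, $f(t+a_1)+f(a_2)=f(t+a_2)+f(a_1)$ implies $a_1=a_2$. It is a bijective Costas cloud if moreover $f$ is a bijection onto $B$. *)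

theory Defs
  imports "HOL-Analysis.Analysis"
begin

definition costas_translations :: "real set \<Rightarrow> real set" where
  "costas_translations A = {t. t \<noteq> 0 \<and> ((+) t ` A) \<inter> A \<noteq> {}}"

definition costas_property :: "real set \<Rightarrow> real set \<Rightarrow> (real \<Rightarrow> real) \<Rightarrow> bool" where
  "costas_property T A f \<longleftrightarrow>
     (\<forall>a\<^sub>1\<in>A. \<forall>a\<^sub>2\<in>A. \<forall>t\<in>T. t + a\<^sub>1 \<in> A \<longrightarrow> t + a\<^sub>2 \<in> A \<longrightarrow>
        f (t + a\<^sub>1) + f a\<^sub>2 = f (t + a\<^sub>2) + f a\<^sub>1 \<longrightarrow> a\<^sub>1 = a\<^sub>2)"

text \<open>A map from \<open>A\<close> to \<open>B\<close> is a total function of which only the values on \<open>A\<close> matter;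
  continuity and the graph are therefore taken relative to \<open>A\<close>.\<close>

definition costas_cloud :: "real set \<Rightarrow> real set \<Rightarrow> (real \<Rightarrow> real) \<Rightarrow> bool" where
  "costas_cloud A B f \<longleftrightarrow>
     is_interval A \<and> is_interval B \<and>
     f ` A \<subseteq> B \<and> inj_on f A \<and>
     (\<forall>x\<in>A. \<not> continuous (at x within A) f) \<and>
     A \<times> B \<subseteq> closure {(x, f x) | x. x \<in> A} \<and>
     costas_property (costas_translations A) A f"

definition bijective_costas_cloud :: "real set \<Rightarrow> real set \<Rightarrow> (real \<Rightarrow> real) \<Rightarrow> bool" where
  "bijective_costas_cloud A B f \<longleftrightarrow> costas_cloud A B f \<and> bij_betw f A B"

lemma bijective_costas_cloud_UNIV_iff:
  "bijective_costas_cloud UNIV {0<..<1} h \<longleftrightarrow>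
     bij_betw h UNIV {0<..<1} \<and>
     (\<forall>x. \<not> isCont h x) \<and>
     UNIV \<times> {0<..<1} \<subseteq> closure {(x, h x) | x. True} \<and>
     (\<forall>x y t. t \<noteq> 0 \<longrightarrow> h (x + t) - h x = h (y + t) - h y \<longrightarrow> x = y)"
proof -
  have T: "costas_translations UNIV = {t. t \<noteq> 0}"
    by (auto simp: costas_translations_def)
  have eq: "h (t + x) + h y = h (t + y) + h x \<longleftrightarrow> h (x + t) - h x = h (y + t) - h y" for x y t
    by (auto simp: algebra_simps)
  have P: "costas_property (costas_translations UNIV) UNIV h \<longleftrightarrow>
     (\<forall>x y t. t \<noteq> 0 \<longrightarrow> h (x + t) - h x = h (y + t) - h y \<longrightarrow> x = y)"
    unfolding costas_property_def T eq by blast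
  have B: "h ` UNIV \<subseteq> {0<..<1}" "inj h" if "bij_betw h UNIV {0<..<1}"
    using that by (simp_all add: bij_betw_def)
  show ?thesis
    unfolding bijective_costas_cloud_def costas_cloud_def P
    using B by (simp add: is_interval_univ is_interval_oo) blast
qed

end

theory Submission
  imports Defs
begin

text \<open>
  A function \<open>h\<close> is injective with the Costas property iff its graph is the graph of an injection
  and a Sidon set in the group \<open>\<real>\<^sup>2\<close>. Such a graph is built by transfinite recursion, meeting
  continuum many requirements (the vertical lines, the horizontal lines, and the open rectangles of
  the strip \<open>\<real> \<times> (0,1)\<close>), each initial segment having fewer than continuum many points. A new point
  can violate the Sidon condition only if both of its coordinates are determined by those of
  earlier points through \<open>x + d = b + c\<close> or \<open>2 x = b + c\<close>; hence one free coordinate always suffices.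
\<close>

section \<open>Transfinite recursion for properties of finite character\<close>

text \<open>Well-order \<open>\<C>\<close> by its cardinal and choose one point of each
  \<open>C\<close> in turn. Every proper initial segment is strictly smaller than
  \<open>\<C>\<close>, so \<open>extend\<close> applies at each stage; finite character carries
  \<open>good\<close> through limit stages.\<close>

lemma transfinite_selection:
  fixes good :: "'a set \<Rightarrow> bool" and \<C> :: "'a set set"
  assumes finite_character: "\<And>G. good G \<longleftrightarrow> (\<forall>F. finite F \<longrightarrow> F \<subseteq> G \<longrightarrow> good F)"
    and empty: "good {}"
    and extend: "\<And>C G. C \<in> \<C> \<Longrightarrow> good G \<Longrightarrow> G \<prec> \<C> \<Longrightarrow> \<exists>q\<in>C. good (insert q G)"
  shows "\<exists>G. good G \<and> (\<forall>C\<in>\<C>. \<exists>q\<in>G. q \<in> C)"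
proof -
  define r where "r = card_of \<C>"
  have r: "Well_order r" "Card_order r" "Field r = \<C>"
    by (simp_all add: r_def card_of_well_order_on card_of_card_order_on Field_card_of)
  then interpret r: wo_rel r
    by (simp add: wo_rel_def)
  have under: "under r a = insert a (underS r a)" if "a \<in> \<C>" for a
    using that r(3) r.REFL by (auto simp: under_def underS_def refl_on_def)
  have small: "f ` underS r a \<prec> \<C>" if "a \<in> \<C>" for a and f :: "'a set \<Rightarrow> 'a"
  proof -
    have "ordLess2 (card_of (underS r a)) (card_of \<C>)"
      using card_of_underS[OF r(2)] that r(3) by (simp add: r_def)
    then have "underS r a \<prec> \<C>"
      unfolding lesspoll_def lepoll_def eqpoll_iff_card_of_ordIso card_of_ordLeq
      using ordLess_imp_ordLeq not_ordLess_ordIso by blast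
    then show ?thesis
      using image_lepoll lesspoll_trans1 by blast
  qed
  \<comment> \<open>A finite subset of \<open>f\<close>
    A\<open>uses finitely many indices; these have a largest one\<close>b\<open>, so the subset lies in\<close>f
    \<open>under r b\<close>, which is good.\<close>
  have chain: "good (f ` A)"
    if A: "A \<subseteq> \<C>" and good: "\<And>a. a \<in> A \<Longrightarrow> good (f ` under r a)" for f :: "'a set \<Rightarrow> 'a" and A
  proof -
    have "good F" if F: "finite F" "F \<subseteq> f ` A" for F
    proof (cases "F = {}")
      case False
      obtain B where B: "finite B" "B \<subseteq> A" "F = f ` B"
        using F finite_subset_image by meson
      have "\<exists>b\<in>B. \<forall>a\<in>B. (a, b) \<in> r"
      proof -
        have "B \<noteq> {}" using B False by auto
        with B(1) have "B \<subseteq> \<C> \<longrightarrow> (\<exists>b\<in>B. \<forall>a\<in>B. (a, b) \<in> r)"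
        proof (induction rule: finite_ne_induct)
          case (singleton x)
          then show ?case using r(3) r.REFL by (auto simp: refl_on_def)
        next
          case (insert x B)
          show ?case
          proof
            assume sub: "insert x B \<subseteq> \<C>"
            with insert obtain b where b: "b \<in> B" "\<forall>a\<in>B. (a, b) \<in> r" by auto
            have xx: "(x, x) \<in> r"
              using sub r(3) r.REFL by (auto simp: refl_on_def)
            consider "(x, b) \<in> r" | "(b, x) \<in> r"
              using sub b r(3) r.TOTALS by blast
            then show "\<exists>b\<in>insert x B. \<forall>a\<in>insert x B. (a, b) \<in> r"
            proof cases
              case 1
              then show ?thesis using b by blast
            next
              case 2
              then have "\<forall>a\<in>B. (a, x) \<in> r"
                using b(2) transD[OF r.TRANS] by blast
              then show ?thesis using xx by blast
            qed
          qed
        qed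
        then show ?thesis using A B by auto
      qed
      then obtain b where "b \<in> B" "B \<subseteq> under r b"
        by (auto simp: under_def)
      then have "good (f ` under r b)" "F \<subseteq> f ` under r b"
        using good B by auto
      then show ?thesis
        using finite_character F(1) by blast
    qed (use empty in simp)
    then show ?thesis
      using finite_character by blast
  qed
  \<comment> \<open>The recursion runs over the whole type, so indices outside \<open>\<C>\<close>
    receive an arbitrary value.\<close>
  let ?P = "\<lambda>f C q. C \<in> \<C> \<longrightarrow> q \<in> C \<and> good (insert q (f ` underS r C))"
  have "\<exists>f. \<forall>C. ?P f C (f C)"
  proof (rule dependent_wf_choice[of "r - Id"])
    show "wf (r - Id)" by (rule r.WF)
  next
    fix f g :: "'a set \<Rightarrow> 'a" and C q
    assume "\<And>z. (z, C) \<in> r - Id \<Longrightarrow> f z = g z"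
    then have "f ` underS r C = g ` underS r C"
      by (intro image_cong) (auto simp: underS_def)
    then show "?P f C q = ?P g C q" by simp
  next
    fix C and f :: "'a set \<Rightarrow> 'a"
    assume IH: "\<And>y. (y, C) \<in> r - Id \<Longrightarrow> ?P f y (f y)"
    show "\<exists>q. ?P f C q"
    proof (cases "C \<in> \<C>")
      case True
      have "good (f ` underS r C)"
      proof (rule chain)
        show sub: "underS r C \<subseteq> \<C>"
          using r(3) by (auto simp: underS_def Field_def)
        fix a assume a: "a \<in> underS r C"
        then have "a \<in> \<C>" using sub by auto
        then show "good (f ` under r a)"
          using IH[of a] a by (auto simp: under underS_def)
      qed
      then show ?thesis
        using extend[OF True _ small[OF True]] by blast
    qed auto
  qed
  then obtain f where f: "\<And>C. C \<in> \<C> \<Longrightarrow> f C \<in> C \<and> good (insert (f C) (f ` underS r C))"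
    by blast
  have "good (f ` \<C>)"
    by (rule chain) (use f in \<open>auto simp: under\<close>)
  then show ?thesis
    using f by blast
qed

section \<open>Cardinal arithmetic\<close>

lemma infinite_Times_self_lepoll: "infinite S \<Longrightarrow> S \<times> S \<lesssim> S"
  using card_of_Times_same_infinite eqpoll_iff_card_of_ordIso eqpoll_imp_lepoll by blast

lemma infinite_Un_lepoll:
  assumes "infinite S" "A \<lesssim> S" "B \<lesssim> S"
  shows "A \<union> B \<lesssim> S"
  using card_of_Un_ordLeq_infinite_Field[of "card_of S" A B] assms
  by (simp add: lepoll_def card_of_ordLeq Field_card_of card_of_card_order_on)

section \<open>Sidon sets in the plane and the values a new point must avoid\<close>

text \<open>The equivalence in the first clause makes \<open>G\<close> single-valued and injective
  at once. The second clause is the Costas property written additively, so that the points of a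
  relation play symmetric roles.\<close>

definition sidon_injection :: "(real \<times> real) set \<Rightarrow> bool" where
  "sidon_injection G \<longleftrightarrow>
     (\<forall>p\<in>G. \<forall>q\<in>G. fst p = fst q \<longleftrightarrow> snd p = snd q) \<and>
     (\<forall>p\<in>G. \<forall>q\<in>G. \<forall>r\<in>G. \<forall>s\<in>G. p + s = q + r \<longrightarrow> p = q \<or> p = r)"

text \<open>Each clause speaks of at most four points at a time.\<close>

lemma sidon_injection_finite_character:
  "sidon_injection G \<longleftrightarrow> (\<forall>F. finite F \<longrightarrow> F \<subseteq> G \<longrightarrow> sidon_injection F)"
proof
  assume "sidon_injection G"
  then show "\<forall>F. finite F \<longrightarrow> F \<subseteq> G \<longrightarrow> sidon_injection F"
    unfolding sidon_injection_def by (meson subsetD)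
next
  assume *: "\<forall>F. finite F \<longrightarrow> F \<subseteq> G \<longrightarrow> sidon_injection F"
  have "sidon_injection {p, q, r, s}" if "p \<in> G" "q \<in> G" "r \<in> G" "s \<in> G" for p q r s
    using * that by simp
  then show "sidon_injection G"
    unfolding sidon_injection_def by (meson insertCI)
qed

text \<open>These are the coordinates forced by a relation with old points in which the new point
  occurs twice on one side or exactly once. A new point on both sides gives a trivial
  relation.\<close>

definition completions :: "real set \<Rightarrow> real set" where
  "completions S = {x. \<exists>b\<in>S. \<exists>c\<in>S. x + x = b + c \<or> (\<exists>d\<in>S. x + d = b + c)}"

lemma subset_completions: "S \<subseteq> completions S"
  by (auto simp: completions_def)

text \<open>Completions are images of pairs and triples from \<open>S\<close>: finitely many for
  finite \<open>S\<close>, and at most as many as \<open>S\<close> for infinite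
  \<open>S\<close>.\<close>

lemma completions_lesspoll:
  assumes "S \<prec> (UNIV :: real set)"
  shows "completions S \<prec> (UNIV :: real set)"
proof -
  let ?A = "(\<lambda>(b, c). (b + c) / 2) ` (S \<times> S)"
  let ?B = "(\<lambda>(b, c, d). b + c - d) ` (S \<times> S \<times> S)"
  have sub: "completions S \<subseteq> ?A \<union> ?B"
  proof
    fix x assume "x \<in> completions S"
    then obtain b c where bc: "b \<in> S" "c \<in> S" and "x + x = b + c \<or> (\<exists>d\<in>S. x + d = b + c)"
      by (auto simp: completions_def)
    then consider "x = (b + c) / 2" | d where "d \<in> S" "x = b + c - d"
      by (auto simp: field_simps)
    then show "x \<in> ?A \<union> ?B"
      by cases (use bc in \<open>force+\<close>)
  qed
  show ?thesis
  proof (cases "finite S")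
    case True
    then have "finite (completions S)"
      using sub by (auto intro: finite_subset)
    then show ?thesis
      by (simp add: finite_lesspoll_infinite infinite_UNIV_char_0)
  next
    case False
    have SS: "S \<times> S \<lesssim> S"
      using False by (rule infinite_Times_self_lepoll)
    then have "S \<times> S \<times> S \<lesssim> S"
      using lepoll_trans[OF times_lepoll_mono[OF lepoll_refl SS] SS] by blast
    with SS have "?A \<lesssim> S" "?B \<lesssim> S"
      using image_lepoll lepoll_trans by blast+
    then have "?A \<union> ?B \<lesssim> S"
      using False by (intro infinite_Un_lepoll)
    then have "completions S \<lesssim> S"
      using sub subset_imp_lepoll lepoll_trans by blast
    then show ?thesis
      using assms lesspoll_trans1 by blast
  qed
qed

lemma ex_notin_completions:
  assumes "I \<approx> (UNIV :: real set)" "S \<prec> (UNIV :: real set)"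
  obtains x where "x \<in> I" "x \<notin> completions S"
proof -
  have "\<not> I \<subseteq> completions S"
  proof
    assume "I \<subseteq> completions S"
    then have "I \<prec> (UNIV :: real set)"
      using completions_lesspoll[OF assms(2)] subset_imp_lepoll lesspoll_trans1 by blast
    then show False
      using assms(1) by (simp add: lesspoll_def)
  qed
  then show ?thesis using that by blast
qed

text \<open>A nontrivial relation involving the new point holds in both coordinates, hence puts both
  into completions; one coordinate outside rules it out. That both coordinates are fresh keeps the
  graph injective.\<close>

lemma sidon_injection_insert:
  assumes G: "sidon_injection G" and "x \<notin> fst ` G" "v \<notin> snd ` G"
    and "x \<notin> completions (fst ` G) \<or> v \<notin> completions (snd ` G)"
  shows "sidon_injection (insert (x, v) G)"
proof -
  let ?n = "(x, v)"
  have mid: "?n + ?n \<noteq> q + r" if "q \<in> G" "r \<in> G" for q r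
    using assms(4) that unfolding completions_def by (auto simp: prod_eq_iff)
  have tri: "?n + s \<noteq> q + r" if "q \<in> G" "r \<in> G" "s \<in> G" for q r s
    using assms(4) that unfolding completions_def by (auto simp: prod_eq_iff)
  \<comment> \<open>The new point stands first here; the symmetries of \<open>p + s = q + r\<close>
    reduce the other positions to this one.\<close>
  have new: "p = q \<or> p = r"
    if "p = ?n" "q \<in> insert ?n G" "r \<in> insert ?n G" "s \<in> insert ?n G" "p + s = q + r" for p q r s
    using that mid tri by (metis insert_iff)
  have sidon: "p = q \<or> p = r"
    if in_G: "p \<in> insert ?n G" "q \<in> insert ?n G" "r \<in> insert ?n G" "s \<in> insert ?n G"
      and eq: "p + s = q + r" for p q r s
  proof -
    consider "p = ?n" | "q = ?n" | "r = ?n" | "s = ?n" | "{p, q, r, s} \<subseteq> G"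
      using in_G by auto
    then show ?thesis
    proof cases
      case 1 then show ?thesis using new in_G eq by blast
    next
      case 2
      then have "q = p \<or> q = s" using new[of q p s r] in_G eq by simp
      then show ?thesis using eq by (auto simp: add.commute)
    next
      case 3
      then have "r = p \<or> r = s" using new[of r p s q] in_G eq by (simp add: add.commute)
      then show ?thesis using eq by auto
    next
      case 4
      then have "s = q \<or> s = r" using new[of s q r p] in_G eq by (simp add: add.commute)
      then show ?thesis using eq by (auto simp: add.commute)
    next
      case 5 then show ?thesis using G eq unfolding sidon_injection_def by blast
    qed
  qed
  have "fst p = fst q \<longleftrightarrow> snd p = snd q" if "p \<in> insert ?n G" "q \<in> insert ?n G" for p q
    using that assms(2,3) G unfolding sidon_injection_def by (metis fst_conv image_eqI insertE snd_conv)
  with sidon show ?thesis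
    unfolding sidon_injection_def by blast
qed

section \<open>The requirements and how to meet each of them\<close>

text \<open>Vertical lines make the function total, horizontal lines make it onto, and rectangles
  give density and discontinuity.\<close>

definition requirements :: "(real \<times> real) set set" where
  "requirements =
     range (\<lambda>x. {x} \<times> {0<..<1}) \<union> (\<lambda>v. UNIV \<times> {v}) ` {0<..<1} \<union>
     {{a<..<b} \<times> {c<..<d} | a b c d. a < b \<and> 0 \<le> c \<and> c < d \<and> d \<le> 1}"

text \<open>Lines are indexed by reals and rectangles by quadruples of reals.\<close>

lemma requirements_lepoll: "requirements \<lesssim> (UNIV :: real set)"
proof -
  let ?R = "UNIV :: real set"
  have inf: "infinite ?R" by (simp add: infinite_UNIV_char_0)
  have RR: "?R \<times> ?R \<lesssim> ?R"
    using inf by (rule infinite_Times_self_lepoll)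
  have R4: "(?R \<times> ?R) \<times> (?R \<times> ?R) \<lesssim> ?R"
    using lepoll_trans[OF times_lepoll_mono[OF RR RR] RR] .
  let ?A = "range (\<lambda>x::real. {x} \<times> {0<..<1::real})"
  let ?B = "(\<lambda>v. ?R \<times> {v}) ` {0<..<1::real}"
  let ?C = "{{a<..<b :: real} \<times> {c<..<d :: real} | a b c d. a < b \<and> 0 \<le> c \<and> c < d \<and> d \<le> 1}"
  have C: "?C \<subseteq> (\<lambda>((a, b), (c, d)). {a<..<b} \<times> {c<..<d}) ` ((?R \<times> ?R) \<times> (?R \<times> ?R))"
    by (force simp: image_iff)
  have "?A \<lesssim> ?R" by (rule image_lepoll)
  moreover have "?B \<lesssim> ?R"
    by (rule subset_image_lepoll[of _ "\<lambda>v. ?R \<times> {v}"]) auto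
  moreover have "?C \<lesssim> ?R"
    by (rule lepoll_trans[OF subset_image_lepoll[OF C] R4])
  ultimately show ?thesis
    unfolding requirements_def by (intro infinite_Un_lepoll inf)
qed

text \<open>A line already met needs no new point. Otherwise one coordinate ranges over a set of
  size continuum and can avoid the fewer than continuum many completions.\<close>

lemma sidon_injection_extend:
  assumes C: "C \<in> requirements" and G: "sidon_injection G" "G \<subseteq> UNIV \<times> {0<..<1}"
    and small: "G \<prec> (UNIV :: real set)"
  shows "\<exists>q\<in>C. sidon_injection (insert q G) \<and> insert q G \<subseteq> UNIV \<times> {0<..<1}"
proof -
  have fst_small: "fst ` G \<prec> (UNIV :: real set)" and snd_small: "snd ` G \<prec> (UNIV :: real set)"
    using small image_lepoll lesspoll_trans1 by blast+
  \<comment> \<open>This serves both the vertical lines and the rectangles; a value outside the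
    completions is in particular fresh.\<close>
  have vertical: "\<exists>v\<in>{c<..<d}. sidon_injection (insert (x, v) G)"
    if "x \<notin> fst ` G" "c < d" for x c d
  proof -
    obtain v where "v \<in> {c<..<d}" "v \<notin> completions (snd ` G)"
      using ex_notin_completions[OF _ snd_small] \<open>c < d\<close> open_interval_eqpoll_reals by blast
    then show ?thesis
      using sidon_injection_insert[OF G(1) that(1), of v] subset_completions by blast
  qed
  consider x where "C = {x} \<times> {0<..<1}" | v where "v \<in> {0<..<1}" "C = UNIV \<times> {v}"
    | a b c d where "C = {a<..<b} \<times> {c<..<d}" "a < b" "0 \<le> c" "c < d" "d \<le> 1"
    using C unfolding requirements_def by blast
  then show ?thesis
  proof cases
    case (1 x)
    show ?thesis
    proof (cases "x \<in> fst ` G")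
      case True
      then obtain q where "q \<in> G" "fst q = x" by auto
      then have "q \<in> C" "insert q G = G" using 1 G(2) by (auto simp: mem_Times_iff)
      then show ?thesis using G by metis
    next
      case False
      then show ?thesis using vertical[of x 0 1] 1 G(2) by auto
    qed
  next
    case (2 v)
    show ?thesis
    proof (cases "v \<in> snd ` G")
      case True
      then obtain q where "q \<in> G" "snd q = v" by auto
      then have "q \<in> C" "insert q G = G" using 2 by (auto simp: mem_Times_iff)
      then show ?thesis using G by metis
    next
      case False
      obtain x where "x \<notin> completions (fst ` G)"
        using ex_notin_completions[OF eqpoll_refl fst_small] by blast
      then have "sidon_injection (insert (x, v) G)"
        using sidon_injection_insert[OF G(1) _ False] subset_completions by blast
      then show ?thesis using 2 G(2) by auto
    qed
  next
    case (3 a b c d)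
    obtain x where "x \<in> {a<..<b}" "x \<notin> completions (fst ` G)"
      using ex_notin_completions[OF _ fst_small] \<open>a < b\<close> open_interval_eqpoll_reals by blast
    moreover from this obtain v where "v \<in> {c<..<d}" "sidon_injection (insert (x, v) G)"
      using vertical[of x c d] \<open>c < d\<close> subset_completions by blast
    ultimately show ?thesis
      using 3 G(2) by (intro bexI[of _ "(x, v)"]) auto
  qed
qed

section \<open>From the selected graph to the cloud\<close>

theorem theorem13:
  shows "\<exists>h :: real \<Rightarrow> real. bijective_costas_cloud UNIV {0<..<1} h"
proof -
  let ?good = "\<lambda>G. sidon_injection G \<and> G \<subseteq> UNIV \<times> {0<..<1}"
  have "\<exists>G. ?good G \<and> (\<forall>C\<in>requirements. \<exists>q\<in>G. q \<in> C)"
  proof (rule transfinite_selection[of ?good])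
    fix G :: "(real \<times> real) set"
    \<comment> \<open>Testing singletons suffices.\<close>
    have "G \<subseteq> UNIV \<times> {0<..<1} \<longleftrightarrow> (\<forall>F. finite F \<longrightarrow> F \<subseteq> G \<longrightarrow> F \<subseteq> UNIV \<times> {0<..<1})"
      by (meson empty_subsetI finite.emptyI finite.insertI insert_subset subsetI subset_trans)
    then show "?good G \<longleftrightarrow> (\<forall>F. finite F \<longrightarrow> F \<subseteq> G \<longrightarrow> ?good F)"
      using sidon_injection_finite_character[of G] by blast
  next
    show "?good {}" by (simp add: sidon_injection_def)
  next
    fix C G assume "C \<in> requirements" "?good G" "G \<prec> requirements"
    then show "\<exists>q\<in>C. ?good (insert q G)"
      using sidon_injection_extend lesspoll_trans2[OF _ requirements_lepoll] by blast
  qed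
  then obtain G where G: "sidon_injection G" "G \<subseteq> UNIV \<times> {0<..<1}"
    and meets: "\<And>C. C \<in> requirements \<Longrightarrow> \<exists>q\<in>G. q \<in> C"
    by blast
  have "\<exists>v. (x, v) \<in> G" for x
    using meets[of "{x} \<times> {0<..<1}"] unfolding requirements_def by auto
  then obtain h where h: "\<And>x. (x, h x) \<in> G"
    by metis
  have G_eq: "v = h x" if "(x, v) \<in> G" for x v
    using that h[of x] G(1) unfolding sidon_injection_def by (metis fst_conv snd_conv)
  have rect: "\<exists>x\<in>{a<..<b}. h x \<in> {c<..<d}" if "a < b" "0 \<le> c" "c < d" "d \<le> 1" for a b c d
  proof -
    have "{a<..<b} \<times> {c<..<d} \<in> requirements"
      using that unfolding requirements_def by blast
    then show ?thesis using meets G_eq by fastforce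
  qed
  have range01: "h x \<in> {0<..<1}" for x
    using h[of x] G(2) by auto
  have "bij_betw h UNIV {0<..<1}"
  proof (rule bij_betwI')
    show "h x = h y \<longleftrightarrow> x = y" for x y
      using h[of x] h[of y] G(1) unfolding sidon_injection_def by (metis fst_conv snd_conv)
    show "\<exists>x\<in>UNIV. v = h x" if "v \<in> {0<..<1}" for v
    proof -
      have "UNIV \<times> {v} \<in> requirements"
        using that unfolding requirements_def by blast
      then show ?thesis using meets G_eq by fastforce
    qed
  qed (use range01 in simp)
  moreover have "\<not> isCont h x" for x
  proof
    assume "isCont h x"
    \<comment> \<open>Continuity would keep \<open>h\<close> above \<open>h x / 2\<close> near
      \<open>x\<close>, but a rectangle of heights between 0 and \<open>h x / 2\<close> is met
      arbitrarily close to \<open>x\<close>.\<close>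
    let ?e = "h x / 2"
    have "?e > 0" using range01[of x] by simp
    with \<open>isCont h x\<close> obtain \<delta> where "\<delta> > 0" and \<delta>: "\<And>y. dist y x < \<delta> \<Longrightarrow> dist (h y) (h x) < ?e"
      unfolding continuous_at_eps_delta by blast
    obtain y where y: "y \<in> {x - \<delta><..<x + \<delta>}" "h y \<in> {0<..<?e}"
      using rect[of "x - \<delta>" "x + \<delta>" 0 ?e] \<open>\<delta> > 0\<close> \<open>?e > 0\<close> range01[of x] by auto
    then have "dist y x < \<delta>" by (auto simp: dist_real_def)
    then show False using \<delta>[of y] y(2) by (auto simp: dist_real_def)
  qed
  moreover have "UNIV \<times> {0<..<1} \<subseteq> closure {(x, h x) | x. True}"
  proof (clarify, unfold closure_approachable, intro allI impI)
    fix x v e :: real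
    assume "v \<in> {0<..<1}" and "0 < e"
    then have v: "0 < v" "v < 1" by auto
    \<comment> \<open>The window around \<open>v\<close> is clipped because only rectangles inside
      the strip are requirements; it stays nonempty since \<open>v\<close> lies strictly between 0
      and 1.\<close>
    let ?c = "max 0 (v - e / 2)" and ?d = "min 1 (v + e / 2)"
    obtain y where y: "y \<in> {x - e / 2<..<x + e / 2}" "h y \<in> {?c<..<?d}"
      using rect[of "x - e / 2" "x + e / 2" ?c ?d] v \<open>0 < e\<close> by auto
    have "dist (y, h y) (x, v) \<le> dist y x + dist (h y) v"
      unfolding dist_Pair_Pair by (rule sqrt_sum_squares_le_sum) auto
    also have "\<dots> < e"
      using y by (auto simp: dist_real_def)
    finally show "\<exists>q\<in>{(x, h x) | x. True}. dist q (x, v) < e"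
      by blast
  qed
  moreover have "x = y" if "t \<noteq> 0" "h (x + t) - h x = h (y + t) - h y" for x y t
  proof -
    \<comment> \<open>Equal increments become a relation between four points of \<open>G\<close>.
      Since \<open>t\<close> is nonzero, its only possible trivial form is
      \<open>x + t = y + t\<close>.\<close>
    have "(x + t, h (x + t)) + (y, h y) = (x, h x) + (y + t, h (y + t))"
      using that(2) by auto
    then have "(x + t, h (x + t)) = (x, h x) \<or> (x + t, h (x + t)) = (y + t, h (y + t))"
      using G(1) h unfolding sidon_injection_def by blast
    then show ?thesis using that(1) by auto
  qed
  ultimately show ?thesis
    unfolding bijective_costas_cloud_UNIV_iff by blast
qed

end
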